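(* Let $\mathbf X\in\mathbb R^{n\times d}$ be a full rank matrix with $n\ge d$. For $s\in\{d,\dots,n\}$, let $S\subseteq\{1,\dots,n\}$ be a size $s$ volume sampled set over $\mathbf X$. Then $$\mathbb E\big[(\mathbf I_S\mathbf X)^+\big]=\mathbf X^+.$$
   Context: $\mathbf X_S$ is the submatrix of the rows of $\mathbf X$ indexed by $S$. $\mathbf I_S$ is the $n\times n$ diagonal matrix with $(\mathbf I_S)_{ii}=1$ if $i\in S$ and $0$ otherwise. $^+$ is the Moore–Penrose pseudoinverse. Size $s$ volume sampling over $\mathbf X$ selects a set $S\subseteq\{1,\dots,n\}$ with $|S|=s$ with probability $P(S)=\dfrac{\det(\mathbf X_S^\top\mathbf X_S)}{\binom{n-d}{s-d}\det(\mathbf X^\top\mathbf X)}$. *)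

theory Defs
  imports
    "HOL-Probability.Probability_Mass_Function"
    "Jordan_Normal_Form.Determinant"
    "Jordan_Normal_Form.DL_Rank"
    "Jordan_Normal_Form.DL_Submatrix"
begin

hide_const (open) Determinants.det Finite_Cartesian_Product.mat Finite_Cartesian_Product.row
  Finite_Cartesian_Product.vec Finite_Cartesian_Product.transpose

text \<open>
  Matrices are those of \<^theory>\<open>Jordan_Normal_Form.Matrix\<close>, whose rows and columns are indexed
  from 0; index sets of rows are therefore subsets of \<open>{..<n}\<close>.
\<close>

definition rows_submatrix :: "'a mat \<Rightarrow> nat set \<Rightarrow> 'a mat" where
  "rows_submatrix X S = submatrix X S UNIV"

definition diag_indicator :: "nat \<Rightarrow> nat set \<Rightarrow> 'a :: zero_neq_one mat" where
  "diag_indicator n S = mat n n (\<lambda>(i, j). if i = j \<and> i \<in> S then 1 else 0)"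

text \<open>The four Penrose conditions; they determine the Moore--Penrose pseudoinverse of a real
  matrix uniquely, so the definite description below is proper.\<close>

definition is_pseudoinverse :: "real mat \<Rightarrow> real mat \<Rightarrow> bool" where
  "is_pseudoinverse A B \<longleftrightarrow>
     B \<in> carrier_mat (dim_col A) (dim_row A) \<and>
     A * B * A = A \<and> B * A * B = B \<and>
     transpose_mat (A * B) = A * B \<and> transpose_mat (B * A) = B * A"

definition pseudoinverse :: "real mat \<Rightarrow> real mat" where
  "pseudoinverse A = (THE B. is_pseudoinverse A B)"

text \<open>For full column rank \<open>X\<close> and \<open>d \<le> s \<le> n\<close> the weights below are nonnegative and sum to 1,
  so \<^const>\<open>embed_pmf\<close> yields exactly this distribution; see \<open>pmf_volume_sampling\<close> at the end of
  this theory.\<close>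

definition volume_sampling :: "nat \<Rightarrow> real mat \<Rightarrow> nat set pmf" where
  "volume_sampling s X = (let n = dim_row X; d = dim_col X in
     embed_pmf (\<lambda>S. if S \<subseteq> {..<n} \<and> card S = s
       then det (transpose_mat (rows_submatrix X S) * rows_submatrix X S) /
              (real ((n - d) choose (s - d)) * det (transpose_mat X * X))
       else 0))"

text \<open>Entrywise expectation of a random \<open>nr \<times> nc\<close> matrix.\<close>

definition expectation_mat :: "nat \<Rightarrow> nat \<Rightarrow> 'a pmf \<Rightarrow> ('a \<Rightarrow> real mat) \<Rightarrow> real mat" where
  "expectation_mat nr nc p F =
     mat nr nc (\<lambda>(i, j). measure_pmf.expectation p (\<lambda>x. F x $$ (i, j)))"


text \<open>
  The remainder proves \<open>pmf_volume_sampling\<close>. Expanding the determinant by rows (as for the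
  Cauchy--Binet formula) writes \<open>det (X\<^sub>S\<^sup>T X\<^sub>S)\<close> as a sum over injections \<open>{..<d} \<rightarrow> S\<close>; each
  injection into \<open>{..<n}\<close> is counted by \<open>(n - d) choose (s - d)\<close> sets \<open>S\<close> of size \<open>s\<close>.
\<close>

definition gram_sum :: "nat \<Rightarrow> real mat \<Rightarrow> nat set \<Rightarrow> real mat" where
  "gram_sum d X S = mat d d (\<lambda>(i, j). \<Sum>a\<in>S. X $$ (a, i) * X $$ (a, j))"

lemma pick_bij:
  assumes "S \<subseteq> {..<n :: nat}"
  shows "bij_betw (pick S) {..<card S} S"
proof -
  have fin: "finite S" using assms finite_subset by blast
  have inj: "inj_on (pick S) {..<card S}"
  proof (rule inj_onI)
    fix i j assume ij: "i \<in> {..<card S}" "j \<in> {..<card S}" "pick S i = pick S j"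
    have "card {a\<in>S. a < pick S i} = i" using ij(1) by (intro card_pick) simp
    moreover have "card {a\<in>S. a < pick S j} = j" using ij(2) by (intro card_pick) simp
    ultimately show "i = j" unfolding ij(3) by (rule trans[OF sym])
  qed
  have "pick S ` {..<card S} \<subseteq> S" by (auto intro!: pick_in_set)
  then have "pick S ` {..<card S} = S"
    using inj fin by (intro card_subset_eq) (auto simp: card_image)
  then show ?thesis using inj by (simp add: bij_betw_def)
qed

lemma gram_rows_submatrix:
  assumes "X \<in> carrier_mat n d" "S \<subseteq> {..<n}"
  shows "transpose_mat (rows_submatrix X S) * rows_submatrix X S = gram_sum d X S"
proof -
  have c: "{i. i < n \<and> i \<in> S} = S" "{j. j < d \<and> j \<in> UNIV} = {..<d}" using assms by auto
  have R: "rows_submatrix X S = mat (card S) d (\<lambda>(i, j). X $$ (pick S i, j))"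
    using assms c by (auto simp: rows_submatrix_def submatrix_def pick_UNIV)
  show ?thesis
  proof (rule eq_matI)
    fix i j assume "i < dim_row (gram_sum d X S)" "j < dim_col (gram_sum d X S)"
    then have ij: "i < d" "j < d" by (auto simp: gram_sum_def)
    have "(transpose_mat (rows_submatrix X S) * rows_submatrix X S) $$ (i, j)
      = (\<Sum>k<card S. X $$ (pick S k, i) * X $$ (pick S k, j))"
      using ij by (simp add: R scalar_prod_def atLeast0LessThan)
    also have "\<dots> = (\<Sum>a\<in>S. X $$ (a, i) * X $$ (a, j))"
      by (rule sum.reindex_bij_betw[OF pick_bij[OF assms(2)]])
    finally show "(transpose_mat (rows_submatrix X S) * rows_submatrix X S) $$ (i, j)
      = gram_sum d X S $$ (i, j)" using ij by (simp add: gram_sum_def)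
  qed (auto simp: R gram_sum_def)
qed

lemma gram_full:
  assumes "X \<in> carrier_mat n d"
  shows "transpose_mat X * X = gram_sum d X {..<n}"
  by (rule eq_matI) (use assms in \<open>auto simp: gram_sum_def scalar_prod_def atLeast0LessThan\<close>)

definition index_maps :: "nat \<Rightarrow> nat set \<Rightarrow> (nat \<Rightarrow> nat) set" where
  "index_maps d S = {f. (\<forall>i\<in>{0..<d}. f i \<in> S) \<and> (\<forall>i. i \<notin> {0..<d} \<longrightarrow> f i = i)}"

definition minor_mat :: "nat \<Rightarrow> real mat \<Rightarrow> (nat \<Rightarrow> nat) \<Rightarrow> real mat" where
  "minor_mat d X f = mat d d (\<lambda>(i, j). X $$ (f i, j))"

lemma finite_index_maps [simp]: "finite S \<Longrightarrow> finite (index_maps d S)"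
  unfolding index_maps_def by (rule finite_bounded_functions) auto

lemma det_gram_sum:
  assumes X: "X \<in> carrier_mat n d" and S: "S \<subseteq> {..<n}"
  shows "det (gram_sum d X S) =
    (\<Sum>f\<in>index_maps d S. (\<Prod>k\<in>{0..<d}. X $$ (f k, k)) * det (minor_mat d X f))"
proof -
  have fin: "finite S" using S finite_subset by blast
  define r where "r a = vec d (\<lambda>j. X $$ (a, j))" for a
  have rc: "r a \<in> carrier_vec d" for a by (simp add: r_def)
  have "gram_sum d X S = mat\<^sub>r d d (\<lambda>i. finsum_vec TYPE(real) d (\<lambda>a. X $$ (a, i) \<cdot>\<^sub>v r a) S)"
    by (rule eq_matI) (auto simp: gram_sum_def r_def index_finsum_vec[OF fin] intro!: sum.cong)
  then have "det (gram_sum d X S) =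
      (\<Sum>f\<in>index_maps d S. det (mat\<^sub>r d d (\<lambda>i. X $$ (f i, i) \<cdot>\<^sub>v r (f i))))"
    using det_linear_rows_sum[OF fin, of "\<lambda>i a. X $$ (a, i) \<cdot>\<^sub>v r a" d]
    by (simp add: index_maps_def r_def)
  also have "\<dots> = (\<Sum>f\<in>index_maps d S. (\<Prod>k\<in>{0..<d}. X $$ (f k, k)) * det (minor_mat d X f))"
  proof (rule sum.cong[OF refl])
    fix f
    have "mat\<^sub>r d d (\<lambda>i. r (f i)) = minor_mat d X f"
      by (rule eq_matI) (auto simp: minor_mat_def r_def)
    then show "det (mat\<^sub>r d d (\<lambda>i. X $$ (f i, i) \<cdot>\<^sub>v r (f i)))
        = (\<Prod>k\<in>{0..<d}. X $$ (f k, k)) * det (minor_mat d X f)"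
      using det_rows_mul[of "\<lambda>i. r (f i)" d "\<lambda>i. X $$ (f i, i)"] rc by auto
  qed
  finally show ?thesis .
qed

lemma det_minor_mat_not_inj:
  assumes "\<not> inj_on f {0..<d}"
  shows "det (minor_mat d X f) = 0"
proof -
  obtain i j where ij: "i < d" "j < d" "i \<noteq> j" "f i = f j"
    using assms by (auto simp: inj_on_def)
  show ?thesis
    by (rule det_identical_rows[OF _ ij(3,1,2)]) (use ij in \<open>auto simp: minor_mat_def\<close>)
qed

lemma det_gram_sum_nonneg:
  assumes X: "X \<in> carrier_mat n d" and S: "S \<subseteq> {..<n}"
  shows "0 \<le> det (gram_sum d X S)"
proof -
  let ?P = "{p. p permutes {0..<d}}" and ?F = "index_maps d S"
  let ?w = "\<lambda>f. (\<Prod>k\<in>{0..<d}. X $$ (f k, k)) * det (minor_mat d X f)"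
  have shift: "sum ?w ?F = (\<Sum>f\<in>?F. ?w (f \<circ> p))" if p: "p \<in> ?P" for p
  proof -
    have pp: "p permutes {0..<d}" using p by simp
    let ?q = "Hilbert_Choice.inv p"
    have q: "?q permutes {0..<d}" using pp by (rule permutes_inv)
    have mem: "f \<circ> g \<in> ?F" if "f \<in> ?F" "g permutes {0..<d}" for f g
      using that permutes_in_image[OF that(2)] permutes_not_in[OF that(2)]
      by (auto simp: index_maps_def)
    have "bij_betw (\<lambda>f. f \<circ> p) ?F ?F"
    proof (rule bij_betw_byWitness[where f' = "\<lambda>f. f \<circ> ?q"])
      show "\<forall>a\<in>?F. (a \<circ> p) \<circ> ?q = a"
        using permutes_inv_o[OF pp] by (simp add: comp_assoc)
      show "\<forall>a\<in>?F. (a \<circ> ?q) \<circ> p = a"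
        using permutes_inv_o[OF pp] by (simp add: comp_assoc)
    qed (use mem pp q in auto)
    then show ?thesis by (rule sum.reindex_bij_betw[symmetric])
  qed
  have sq: "(\<Sum>p\<in>?P. ?w (f \<circ> p)) = (det (minor_mat d X f))\<^sup>2" for f
  proof -
    let ?M = "minor_mat d X f"
    have M: "?M \<in> carrier_mat d d" by (simp add: minor_mat_def)
    have "?w (f \<circ> p) = of_int (sign p) * (\<Prod>k\<in>{0..<d}. (transpose_mat ?M) $$ (k, p k)) * det ?M"
      if p: "p permutes {0..<d}" for p
    proof -
      have "minor_mat d X (f \<circ> p) = mat d d (\<lambda>(i, j). ?M $$ (p i, j))"
        using permutes_in_image[OF p] by (intro eq_matI) (auto simp: minor_mat_def)
      then have "det (minor_mat d X (f \<circ> p)) = of_int (sign p) * det ?M"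
        using det_permute_rows[OF M p] by simp
      moreover have "(\<Prod>k\<in>{0..<d}. (transpose_mat ?M) $$ (k, p k))
          = (\<Prod>k\<in>{0..<d}. X $$ ((f \<circ> p) k, k))"
        using permutes_in_image[OF p] by (intro prod.cong) (auto simp: minor_mat_def)
      ultimately show ?thesis by simp
    qed
    then have "(\<Sum>p\<in>?P. ?w (f \<circ> p)) = det (transpose_mat ?M) * det ?M"
      using M by (subst det_def'[of "transpose_mat ?M" d]) (auto simp: sum_distrib_right)
    then show ?thesis using det_transpose[OF M] by (simp add: power2_eq_square)
  qed
  have "real (card ?P) * sum ?w ?F = (\<Sum>p\<in>?P. \<Sum>f\<in>?F. ?w (f \<circ> p))"
    using sum.cong[OF refl shift, of ?P "\<lambda>p. p"] by simp
  also have "\<dots> = (\<Sum>f\<in>?F. (det (minor_mat d X f))\<^sup>2)"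
    by (subst sum.swap) (simp only: sq)
  also have "\<dots> \<ge> 0" by (intro sum_nonneg) auto
  finally have "0 \<le> real (card ?P) * sum ?w ?F" .
  moreover have "card ?P > 0"
    using card_permutations[of "{0..<d}" d] by simp
  ultimately have "0 \<le> sum ?w ?F" by (simp add: zero_le_mult_iff)
  then show ?thesis by (simp only: det_gram_sum[OF X S])
qed

lemma card_supersets:
  assumes "T \<subseteq> {..<n :: nat}" "card T = d" "d \<le> s" "s \<le> n"
  shows "card {S. S \<subseteq> {..<n} \<and> card S = s \<and> T \<subseteq> S} = (n - d) choose (s - d)"
proof -
  have fin: "finite T" using assms finite_subset by blast
  have "bij_betw (\<lambda>U. U \<union> T) {U. U \<subseteq> {..<n} - T \<and> card U = s - d}
     {S. S \<subseteq> {..<n} \<and> card S = s \<and> T \<subseteq> S}"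
  proof (rule bij_betw_byWitness[where f' = "\<lambda>S. S - T"])
    show "(\<lambda>U. U \<union> T) ` {U. U \<subseteq> {..<n} - T \<and> card U = s - d}
      \<subseteq> {S. S \<subseteq> {..<n} \<and> card S = s \<and> T \<subseteq> S}"
    proof safe
      fix U assume U: "U \<subseteq> {..<n} - T" "card U = s - d"
      then have "finite U" "U \<inter> T = {}" using finite_subset by blast+
      then show "card (U \<union> T) = s" using U assms fin by (simp add: card_Un_disjoint)
    qed (use assms in auto)
    show "(\<lambda>S. S - T) ` {S. S \<subseteq> {..<n} \<and> card S = s \<and> T \<subseteq> S}
      \<subseteq> {U. U \<subseteq> {..<n} - T \<and> card U = s - d}"
      using assms fin by (auto simp: card_Diff_subset)
  qed auto
  then have "card {S. S \<subseteq> {..<n} \<and> card S = s \<and> T \<subseteq> S}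
     = card {U. U \<subseteq> {..<n} - T \<and> card U = s - d}" by (simp add: bij_betw_same_card)
  also have "\<dots> = card ({..<n} - T) choose (s - d)" by (rule n_subsets) simp
  also have "card ({..<n} - T) = n - d" using assms fin by (simp add: card_Diff_subset)
  finally show ?thesis .
qed

lemma sum_det_gram_sum:
  assumes X: "X \<in> carrier_mat n d" and s: "d \<le> s" "s \<le> n"
  shows "(\<Sum>S | S \<subseteq> {..<n} \<and> card S = s. det (gram_sum d X S))
    = real ((n - d) choose (s - d)) * det (gram_sum d X {..<n})"
proof -
  let ?w = "\<lambda>f. (\<Prod>k\<in>{0..<d}. X $$ (f k, k)) * det (minor_mat d X f)"
  let ?A = "{S. S \<subseteq> {..<n} \<and> card S = s}" and ?F = "index_maps d {..<n}"
  have finA: "finite ?A" by simp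
  have "(\<Sum>S\<in>?A. det (gram_sum d X S)) = (\<Sum>S\<in>?A. \<Sum>f\<in>?F. if f ` {0..<d} \<subseteq> S then ?w f else 0)"
  proof (rule sum.cong[OF refl])
    fix S assume "S \<in> ?A"
    then have S: "S \<subseteq> {..<n}" by simp
    have "index_maps d S = {f \<in> ?F. f ` {0..<d} \<subseteq> S}"
      using S by (auto simp: index_maps_def)
    then show "det (gram_sum d X S) = (\<Sum>f\<in>?F. if f ` {0..<d} \<subseteq> S then ?w f else 0)"
      by (simp only: det_gram_sum[OF X S] sum.inter_filter[OF finite_index_maps, OF finite_lessThan])
  qed
  also have "\<dots> = (\<Sum>f\<in>?F. \<Sum>S\<in>?A. if f ` {0..<d} \<subseteq> S then ?w f else 0)"
    by (rule sum.swap)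
  also have "\<dots> = (\<Sum>f\<in>?F. real ((n - d) choose (s - d)) * ?w f)"
  proof (rule sum.cong[OF refl])
    fix f assume f: "f \<in> ?F"
    have e: "{S \<in> ?A. f ` {0..<d} \<subseteq> S} = {S. S \<subseteq> {..<n} \<and> card S = s \<and> f ` {0..<d} \<subseteq> S}" by auto
    have "(\<Sum>S\<in>?A. if f ` {0..<d} \<subseteq> S then ?w f else 0)
        = real (card {S. S \<subseteq> {..<n} \<and> card S = s \<and> f ` {0..<d} \<subseteq> S}) * ?w f"
      using sum.inter_filter[OF finA, of "\<lambda>_. ?w f" "\<lambda>S. f ` {0..<d} \<subseteq> S"] e by simp
    also have "\<dots> = real ((n - d) choose (s - d)) * ?w f"
    proof (cases "inj_on f {0..<d}")
      case True
      have "f ` {0..<d} \<subseteq> {..<n}" using f by (auto simp: index_maps_def)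
      then show ?thesis using card_supersets[of "f ` {0..<d}" n d s] card_image[OF True] s by simp
    next
      case False
      then show ?thesis by (simp add: det_minor_mat_not_inj)
    qed
    finally show "(\<Sum>S\<in>?A. if f ` {0..<d} \<subseteq> S then ?w f else 0)
      = real ((n - d) choose (s - d)) * ?w f" .
  qed
  also have "\<dots> = real ((n - d) choose (s - d)) * det (gram_sum d X {..<n})"
    by (simp only: det_gram_sum[OF X order_refl] sum_distrib_left)
  finally show ?thesis .
qed

lemma full_rank_mult_vec_eq_0:
  fixes X :: "real mat"
  assumes X: "X \<in> carrier_mat n d" and rk: "vec_space.rank n X = d"
    and v: "v \<in> carrier_vec d" and Xv: "X *\<^sub>v v = 0\<^sub>v n"
  shows "v = 0\<^sub>v d"
proof (rule ccontr)
  assume v0: "v \<noteq> 0\<^sub>v d"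
  interpret V: vec_space "TYPE(real)" n .
  have dist: "distinct (cols X)"
  proof (rule ccontr)
    assume nd: "\<not> distinct (cols X)"
    have "finite (set (cols X))" by simp
    obtain S where S: "maximal S (\<lambda>T. T \<subseteq> set (cols X) \<and> V.lin_indpt T)"
      using maximal_exists_superset[of "set (cols X)" "\<lambda>T. T \<subseteq> set (cols X) \<and> V.lin_indpt T" "{}"]
      by (auto simp: V.lin_dep_def)
    then have "S \<subseteq> set (cols X)" by (simp add: maximal_def)
    then have "card S \<le> card (set (cols X))" by (simp add: card_mono)
    also have "\<dots> < length (cols X)"
      using nd card_distinct card_length[of "cols X"] by (metis le_neq_implies_less)
    finally show False using V.rank_card_indpt[OF X S] rk X by simp
  qed
  then show False
    using V.lin_depI[OF X v v0 Xv] V.full_rank_lin_indpt[OF X rk] by simp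
qed

lemma det_gram_pos:
  fixes X :: "real mat"
  assumes X: "X \<in> carrier_mat n d" and rk: "vec_space.rank n X = d"
  shows "0 < det (transpose_mat X * X)"
proof -
  have "det (transpose_mat X * X) \<noteq> 0"
  proof
    assume "det (transpose_mat X * X) = 0"
    then obtain v where v: "v \<in> carrier_vec d" "v \<noteq> 0\<^sub>v d" "(transpose_mat X * X) *\<^sub>v v = 0\<^sub>v d"
      using det_0_iff_vec_prod_zero_field[of "transpose_mat X * X" d] X by auto
    have Xv: "X *\<^sub>v v \<in> carrier_vec n" using X v by auto
    have "(X *\<^sub>v v) \<bullet> (X *\<^sub>v v) = v \<bullet> (transpose_mat X *\<^sub>v (X *\<^sub>v v))"
      using transpose_vec_mult_scalar[OF X v(1) Xv] Xv v X
      by (metis comm_scalar_prod mult_mat_vec_carrier transpose_carrier_mat)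
    also have "transpose_mat X *\<^sub>v (X *\<^sub>v v) = 0\<^sub>v d"
      using v X by (metis assoc_mult_mat_vec transpose_carrier_mat)
    finally have "(X *\<^sub>v v) \<bullet> (X *\<^sub>v v) = 0" using v by simp
    then have "(\<Sum>i\<in>{0..<n}. ((X *\<^sub>v v) $ i)\<^sup>2) = 0"
      using Xv unfolding scalar_prod_def power2_eq_square by (metis carrier_vecD)
    then have "\<forall>i\<in>{0..<n}. (X *\<^sub>v v) $ i = 0"
      using sum_nonneg_eq_0_iff[of "{0..<n}" "\<lambda>i. ((X *\<^sub>v v) $ i)\<^sup>2"]
      by (simp del: index_mult_mat_vec)
    then have "X *\<^sub>v v = 0\<^sub>v n" using Xv X by (intro eq_vecI) (auto simp del: index_mult_mat_vec)
    then show False using full_rank_mult_vec_eq_0[OF X rk v(1)] v by simp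
  qed
  moreover have "0 \<le> det (transpose_mat X * X)"
    using det_gram_sum_nonneg[OF X order_refl] gram_full[OF X] by simp
  ultimately show ?thesis by simp
qed

theorem pmf_volume_sampling:
  assumes X: "X \<in> carrier_mat n d" and rk: "vec_space.rank n X = d" and s: "d \<le> s" "s \<le> n"
  shows "pmf (volume_sampling s X) S =
    (if S \<subseteq> {..<n} \<and> card S = s
     then det (transpose_mat (rows_submatrix X S) * rows_submatrix X S) /
            (real ((n - d) choose (s - d)) * det (transpose_mat X * X))
     else 0)" (is "_ = ?g S")
proof -
  let ?A = "{S. S \<subseteq> {..<n} \<and> card S = s}"
  let ?c = "real ((n - d) choose (s - d)) * det (transpose_mat X * X)"
  have c: "?c > 0" using det_gram_pos[OF X rk] s by simp
  have g: "?g S = det (gram_sum d X S) / ?c" if "S \<in> ?A" for S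
    using that gram_rows_submatrix[OF X, of S] by simp
  have nn: "0 \<le> ?g S" for S
  proof (cases "S \<in> ?A")
    case True
    then have "0 \<le> det (gram_sum d X S)" using det_gram_sum_nonneg[OF X, of S] by simp
    then have "0 \<le> det (gram_sum d X S) / ?c" using c by (rule divide_nonneg_pos)
    then show ?thesis by (simp only: g[OF True])
  qed auto
  have "sum ?g ?A = (\<Sum>S\<in>?A. det (gram_sum d X S) / ?c)" using g by (rule sum.cong[OF refl])
  also have "\<dots> = (\<Sum>S\<in>?A. det (gram_sum d X S)) / ?c" by (rule sum_divide_distrib[symmetric])
  also have "(\<Sum>S\<in>?A. det (gram_sum d X S)) = ?c"
    using sum_det_gram_sum[OF X s] by (simp only: gram_full[OF X])
  also have "?c / ?c = 1" using c by (intro divide_self) linarith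
  finally have one: "sum ?g ?A = 1" .
  have "(\<integral>\<^sup>+ S. ennreal (?g S) \<partial>count_space UNIV) = (\<Sum>S\<in>?A. ennreal (?g S))"
    by (rule nn_integral_count_space') (auto)
  also have "\<dots> = ennreal (sum ?g ?A)" using nn by (intro sum_ennreal) blast
  finally have "(\<integral>\<^sup>+ S. ennreal (?g S) \<partial>count_space UNIV) = 1" using one by simp
  moreover have "volume_sampling s X = embed_pmf ?g"
    using X by (simp add: volume_sampling_def Let_def)
  ultimately show ?thesis using pmf_embed_pmf[of ?g S, OF nn] by (simp only:)
qed

end

theory Submission
  imports Defs
begin

text \<open>
  Put \<open>A = I\<^sub>S X\<close>. Since \<open>A\<^sup>T A A\<^sup>+ = A\<^sup>T\<close>, Cramer's rule writes \<open>det (A\<^sup>T A)\<close> times entry \<open>(i, j)\<close> of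
  \<open>A\<^sup>+\<close> as the determinant of \<open>A\<^sup>T A\<close> with column \<open>i\<close> replaced by row \<open>j\<close> of \<open>A\<close>. This numerator equals
  \<open>det (X\<^sub>S\<^sup>T Y\<^sub>S)\<close>, where \<open>Y\<close> is \<open>X\<close> with column \<open>i\<close> replaced by the unit vector \<open>e\<^sub>j\<close>. The
  Cauchy--Binet counting argument that normalises volume sampling applies to two different factors
  as well, so the sum of these numerators over all \<open>S\<close> of size \<open>s\<close> is \<open>(n - d) choose (s - d)\<close> times
  the numerator for the full index set.
\<close>

section \<open>Uniqueness and existence of the Moore-Penrose pseudoinverse\<close>

text \<open>\<open>A * B\<close> and \<open>A * C\<close> are symmetric projections onto the same
  range, hence equal; likewise \<open>B * A\<close> and \<open>C * A\<close>. Then B = B A B = B A C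
  = C A C = C.\<close>

lemma is_pseudoinverse_unique:
  assumes B: "is_pseudoinverse A B" and C: "is_pseudoinverse A C"
  shows "B = C"
proof -
  let ?n = "dim_row A" and ?d = "dim_col A"
  have A: "A \<in> carrier_mat ?n ?d" by simp
  have Bc: "B \<in> carrier_mat ?d ?n" and Cc: "C \<in> carrier_mat ?d ?n"
    using B C by (auto simp: is_pseudoinverse_def)
  have B': "A * B * A = A" "B * A * B = B" "transpose_mat (A * B) = A * B" "transpose_mat (B * A) = B * A"
    and C': "A * C * A = A" "C * A * C = C" "transpose_mat (A * C) = A * C" "transpose_mat (C * A) = C * A"
    using B C by (auto simp: is_pseudoinverse_def)
  have AB: "A * B \<in> carrier_mat ?n ?n" and AC: "A * C \<in> carrier_mat ?n ?n"
    and BA: "B * A \<in> carrier_mat ?d ?d" and CA: "C * A \<in> carrier_mat ?d ?d"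
    using Bc Cc by auto
  have eq: "A * B = A * C * (A * B)"
    using assoc_mult_mat[OF AC A Bc] C'(1) by simp
  have "A * B = transpose_mat (A * B)" by (rule B'(3)[symmetric])
  also have "\<dots> = transpose_mat (A * C * (A * B))" by (rule arg_cong[OF eq])
  also have "\<dots> = A * B * (A * C)"
    using transpose_mult[OF AC AB] B'(3) C'(3) by simp
  also have "\<dots> = A * C"
    using assoc_mult_mat[OF AB A Cc] B'(1) by simp
  finally have 1: "A * B = A * C" .
  have eq: "C * A = C * A * (B * A)"
    using assoc_mult_mat[OF Cc A BA] assoc_mult_mat[OF A Bc A] B'(1) by simp
  have "C * A = transpose_mat (C * A)" by (rule C'(4)[symmetric])
  also have "\<dots> = transpose_mat (C * A * (B * A))" by (rule arg_cong[OF eq])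
  also have "\<dots> = B * A * (C * A)"
    using transpose_mult[OF CA BA] B'(4) C'(4) by simp
  also have "\<dots> = B * A"
    using assoc_mult_mat[OF Bc A CA] assoc_mult_mat[OF A Cc A] C'(1) by simp
  finally have 2: "C * A = B * A" .
  have "B = B * (A * C)"
    using assoc_mult_mat[OF Bc A Bc] B'(2) 1 by simp
  also have "\<dots> = C * A * C"
    using assoc_mult_mat[OF Bc A Cc] 2 by simp
  finally show ?thesis using C'(2) by simp
qed

lemma pseudoinverse_eqI: "is_pseudoinverse A B \<Longrightarrow> pseudoinverse A = B"
  unfolding pseudoinverse_def by (rule the_equality) (auto intro: is_pseudoinverse_unique)

text \<open>The inverse \<open>H\<close> of the Gram matrix gives the witness H A^T. It is a left
  inverse of \<open>A\<close>, which leaves only the symmetry of A H A^T to check; that follows from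
  the symmetry of \<open>H\<close>.\<close>

lemma is_pseudoinverse_pseudoinverse:
  assumes A: "A \<in> carrier_mat n d" and det: "det (transpose_mat A * A) \<noteq> 0"
  shows "is_pseudoinverse A (pseudoinverse A)"
proof -
  let ?T = "transpose_mat A"
  let ?G = "?T * A"
  have T: "?T \<in> carrier_mat d n" and G: "?G \<in> carrier_mat d d" using A by auto
  from det_non_zero_imp_unit[OF G det] obtain H where H: "H \<in> carrier_mat d d"
    and HG: "H * ?G = 1\<^sub>m d" and GH: "?G * H = 1\<^sub>m d"
    by (auto simp: Units_def ring_mat_def)
  have Gsym: "transpose_mat ?G = ?G"
    using transpose_mult[OF T A] by simp
  \<comment> \<open>Transposing \<open>H * ?G = 1\<close> makes H^T a right inverse of the symmetric
    \<open>?G\<close>, and it must coincide with the left inverse \<open>H\<close>.\<close>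
  have "H = transpose_mat H"
  proof -
    have tH: "transpose_mat H \<in> carrier_mat d d" using H by simp
    have "transpose_mat (H * ?G) = ?G * transpose_mat H"
      using transpose_mult[OF H G] Gsym by simp
    then have "?G * transpose_mat H = 1\<^sub>m d" using HG by simp
    then show ?thesis
      using assoc_mult_mat[OF H G tH] HG tH H by simp
  qed
  note Hsym = this[symmetric]
  have HT: "H * ?T \<in> carrier_mat d n" using H A by auto
  have BA: "H * ?T * A = 1\<^sub>m d" using assoc_mult_mat[OF H T A] HG by simp
  have "transpose_mat (A * (H * ?T)) = A * (H * ?T)"
    using transpose_mult[OF A HT] transpose_mult[OF H T] assoc_mult_mat[OF A H T] Hsym by simp
  moreover have "A * (H * ?T) * A = A"
    using assoc_mult_mat[OF A HT A] BA A by simp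
  ultimately have "is_pseudoinverse A (H * ?T)"
    using BA HT A left_mult_one_mat[OF HT] by (simp add: is_pseudoinverse_def)
  then show ?thesis by (simp add: pseudoinverse_eqI)
qed

text \<open>These are the normal equations: each column of \<open>B\<close> solves a square linear
  system with the Gram matrix, the form that Cramer's rule needs.\<close>

lemma gram_mult_pseudoinverse:
  assumes "is_pseudoinverse A B"
  shows "transpose_mat A * A * B = transpose_mat A"
proof -
  let ?T = "transpose_mat A"
  have A: "A \<in> carrier_mat (dim_row A) (dim_col A)"
    and T: "?T \<in> carrier_mat (dim_col A) (dim_row A)" by auto
  have B: "B \<in> carrier_mat (dim_col A) (dim_row A)" and AB: "transpose_mat (A * B) = A * B"
    and ABA: "A * B * A = A"
    using assms by (auto simp: is_pseudoinverse_def)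
  have "?T * A * B = ?T * transpose_mat (A * B)"
    using assoc_mult_mat[OF T A B] AB by simp
  also have "\<dots> = transpose_mat (A * B * A)"
    by (rule transpose_mult[OF mult_carrier_mat[OF A B] A, symmetric])
  finally show ?thesis by (simp only: ABA)
qed

section \<open>Cramer's rule for the entries of the pseudoinverse\<close>

lemma mult_mat_vec_eq_0_if_gram:
  fixes A :: "real mat"
  assumes A: "A \<in> carrier_mat n d" and v: "v \<in> carrier_vec d"
    and eq: "(transpose_mat A * A) *\<^sub>v v = 0\<^sub>v d"
  shows "A *\<^sub>v v = 0\<^sub>v n"
proof -
  have Av: "A *\<^sub>v v \<in> carrier_vec n" using A v by auto
  have "(A *\<^sub>v v) \<bullet> (A *\<^sub>v v) = v \<bullet> (transpose_mat A *\<^sub>v (A *\<^sub>v v))"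
    using transpose_vec_mult_scalar[OF A v Av] Av v A
    by (metis comm_scalar_prod mult_mat_vec_carrier transpose_carrier_mat)
  also have "transpose_mat A *\<^sub>v (A *\<^sub>v v) = 0\<^sub>v d"
    using v A eq by (metis assoc_mult_mat_vec transpose_carrier_mat)
  finally have "(A *\<^sub>v v) \<bullet> (A *\<^sub>v v) = 0" using v by simp
  then show ?thesis
    using conjugate_square_eq_0_vec[OF Av] by simp
qed

text \<open>A nonzero kernel vector of the Gram matrix is also killed by \<open>A\<close>, so it is
  orthogonal to \<open>row A j\<close> as well as to every row of the Gram matrix. By symmetry these
  are all the columns of the modified matrix, whose transpose is therefore singular.\<close>

lemma det_replace_col_gram_eq_0:
  fixes A :: "real mat"
  assumes A: "A \<in> carrier_mat n d" and j: "j < n"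
    and det: "det (transpose_mat A * A) = 0"
  shows "det (replace_col (transpose_mat A * A) (row A j) i) = 0"
proof -
  let ?G = "transpose_mat A * A"
  let ?M = "replace_col ?G (row A j) i"
  have G: "?G \<in> carrier_mat d d" using A by simp
  then have M: "?M \<in> carrier_mat d d" by (auto simp: replace_col_def)
  obtain v where v: "v \<in> carrier_vec d" "v \<noteq> 0\<^sub>v d" and Gv: "?G *\<^sub>v v = 0\<^sub>v d"
    using det det_0_iff_vec_prod_zero_field[OF G] by auto
  have Av: "A *\<^sub>v v = 0\<^sub>v n" by (rule mult_mat_vec_eq_0_if_gram[OF A v(1) Gv])
  have "transpose_mat ?M *\<^sub>v v = 0\<^sub>v d"
  proof (rule eq_vecI)
    fix k assume "k < dim_vec (0\<^sub>v d :: real vec)"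
    then have k: "k < d" by simp
    have "col ?M k = (if k = i then row A j else row ?G k)"
      using A k by (intro eq_vecI)
        (auto simp: replace_col_def intro!: comm_scalar_prod[of _ n])
    moreover have "row A j \<bullet> v = 0"
      using arg_cong[OF Av, of "\<lambda>w. w $ j"] A j by simp
    moreover have "row ?G k \<bullet> v = 0"
      using arg_cong[OF Gv, of "\<lambda>w. w $ k"] A k by simp
    ultimately show "(transpose_mat ?M *\<^sub>v v) $ k = 0\<^sub>v d $ k"
      using M k by simp
  qed (use M in auto)
  then have "det (transpose_mat ?M) = 0"
    using v M det_0_iff_vec_prod_zero_field[of "transpose_mat ?M" d] by auto
  then show ?thesis using det_transpose[OF M] by simp
qed

text \<open>Both sides vanish if \<open>A\<close> is rank deficient, so the sampled sets \<open>S\<close> with singular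
  \<open>X\<^sub>S\<^sup>T X\<^sub>S\<close> need no separate treatment.\<close>

lemma det_gram_mult_pseudoinverse:
  assumes A: "A \<in> carrier_mat n d" and i: "i < d" and j: "j < n"
  shows "det (transpose_mat A * A) * pseudoinverse A $$ (i, j)
    = det (replace_col (transpose_mat A * A) (row A j) i)"
proof (cases "det (transpose_mat A * A) = 0")
  case True
  then show ?thesis using det_replace_col_gram_eq_0[OF A j] by simp
next
  case False
  let ?G = "transpose_mat A * A" and ?B = "pseudoinverse A"
  have pinv: "is_pseudoinverse A ?B" by (rule is_pseudoinverse_pseudoinverse[OF A False])
  then have B: "?B \<in> carrier_mat d n" using A by (simp add: is_pseudoinverse_def)
  have G: "?G \<in> carrier_mat d d" using A by simp
  have "?G *\<^sub>v col ?B j = col (?G * ?B) j" by (rule col_mult2[OF G B j, symmetric])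
  also have "\<dots> = row A j" using gram_mult_pseudoinverse[OF pinv] A j by simp
  finally show ?thesis
    using cramer_lemma_mat[OF G _ i, of "col ?B j"] B i j by simp
qed

section \<open>Cauchy-Binet expansion and summation over the sets of size s\<close>

text \<open>The product of X_S^T and Y_S, written without renumbering the rows in S;
  \<open>gram_sum\<close> is the case Y = X.\<close>

definition cross_gram :: "nat \<Rightarrow> real mat \<Rightarrow> real mat \<Rightarrow> nat set \<Rightarrow> real mat" where
  "cross_gram d X Y S = mat d d (\<lambda>(i, j). \<Sum>a\<in>S. X $$ (a, i) * Y $$ (a, j))"

text \<open>Each row of the matrix is a combination of rows of \<open>Y\<close> with coefficients
  from \<open>X\<close>. Multilinearity yields one term for each choice \<open>f\<close> of a row
  index in \<open>S\<close> per row.\<close>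

lemma det_cross_gram:
  assumes fin: "finite S"
  shows "det (cross_gram d X Y S) =
    (\<Sum>f\<in>index_maps d S. (\<Prod>k\<in>{0..<d}. X $$ (f k, k)) * det (minor_mat d Y f))"
proof -
  define r where "r a = vec d (\<lambda>j. Y $$ (a, j))" for a
  have "cross_gram d X Y S = mat\<^sub>r d d (\<lambda>i. finsum_vec TYPE(real) d (\<lambda>a. X $$ (a, i) \<cdot>\<^sub>v r a) S)"
    by (rule eq_matI) (auto simp: cross_gram_def r_def index_finsum_vec[OF fin] intro!: sum.cong)
  then have "det (cross_gram d X Y S) =
      (\<Sum>f\<in>index_maps d S. det (mat\<^sub>r d d (\<lambda>i. X $$ (f i, i) \<cdot>\<^sub>v r (f i))))"
    using det_linear_rows_sum[OF fin, of "\<lambda>i a. X $$ (a, i) \<cdot>\<^sub>v r a" d]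
    by (simp add: index_maps_def r_def)
  also have "\<dots> = (\<Sum>f\<in>index_maps d S. (\<Prod>k\<in>{0..<d}. X $$ (f k, k)) * det (minor_mat d Y f))"
  proof (rule sum.cong[OF refl])
    fix f
    have "mat\<^sub>r d d (\<lambda>i. r (f i)) = minor_mat d Y f"
      by (rule eq_matI) (auto simp: minor_mat_def r_def)
    then show "det (mat\<^sub>r d d (\<lambda>i. X $$ (f i, i) \<cdot>\<^sub>v r (f i)))
        = (\<Prod>k\<in>{0..<d}. X $$ (f k, k)) * det (minor_mat d Y f)"
      using det_rows_mul[of "\<lambda>i. r (f i)" d "\<lambda>i. X $$ (f i, i)"] by (auto simp: r_def)
  qed
  finally show ?thesis .
qed

text \<open>After exchanging the sums, the term of \<open>f\<close> is counted once for each
  \<open>S\<close> containing its image. This number is the same binomial coefficient for all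
  injective \<open>f\<close>; for the others the minor has two equal rows and vanishes.\<close>

lemma sum_det_cross_gram:
  assumes s: "d \<le> s" "s \<le> n"
  shows "(\<Sum>S | S \<subseteq> {..<n} \<and> card S = s. det (cross_gram d X Y S))
    = real ((n - d) choose (s - d)) * det (cross_gram d X Y {..<n})"
proof -
  let ?w = "\<lambda>f. (\<Prod>k\<in>{0..<d}. X $$ (f k, k)) * det (minor_mat d Y f)"
  let ?A = "{S. S \<subseteq> {..<n} \<and> card S = s}" and ?F = "index_maps d {..<n}"
  have "(\<Sum>S\<in>?A. det (cross_gram d X Y S))
      = (\<Sum>S\<in>?A. \<Sum>f\<in>?F. if f ` {0..<d} \<subseteq> S then ?w f else 0)"
  proof (rule sum.cong[OF refl])
    fix S assume "S \<in> ?A"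
    then have S: "S \<subseteq> {..<n}" by simp
    \<comment> \<open>Filtering the maps into \<open>{..<n}\<close> makes the inner range
      independent of \<open>S\<close>, so that the sums can be exchanged.\<close>
    have "index_maps d S = {f \<in> ?F. f ` {0..<d} \<subseteq> S}"
      using S by (auto simp: index_maps_def)
    then show "det (cross_gram d X Y S) = (\<Sum>f\<in>?F. if f ` {0..<d} \<subseteq> S then ?w f else 0)"
      by (simp only: det_cross_gram[OF finite_subset[OF S finite_lessThan]]
          sum.inter_filter[OF finite_index_maps, OF finite_lessThan])
  qed
  also have "\<dots> = (\<Sum>f\<in>?F. \<Sum>S\<in>?A. if f ` {0..<d} \<subseteq> S then ?w f else 0)"
    by (rule sum.swap)
  also have "\<dots> = (\<Sum>f\<in>?F. real ((n - d) choose (s - d)) * ?w f)"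
  proof (rule sum.cong[OF refl])
    fix f assume f: "f \<in> ?F"
    have e: "{S \<in> ?A. f ` {0..<d} \<subseteq> S} = {S. S \<subseteq> {..<n} \<and> card S = s \<and> f ` {0..<d} \<subseteq> S}"
      by auto
    have "(\<Sum>S\<in>?A. if f ` {0..<d} \<subseteq> S then ?w f else 0)
        = real (card {S. S \<subseteq> {..<n} \<and> card S = s \<and> f ` {0..<d} \<subseteq> S}) * ?w f"
      using sum.inter_filter[of ?A "\<lambda>_. ?w f" "\<lambda>S. f ` {0..<d} \<subseteq> S"] e by simp
    also have "\<dots> = real ((n - d) choose (s - d)) * ?w f"
    proof (cases "inj_on f {0..<d}")
      case True
      have "f ` {0..<d} \<subseteq> {..<n}" using f by (auto simp: index_maps_def)
      then show ?thesis using card_supersets[of "f ` {0..<d}" n d s] card_image[OF True] s by simp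
    next
      case False
      then show ?thesis by (simp add: det_minor_mat_not_inj)
    qed
    finally show "(\<Sum>S\<in>?A. if f ` {0..<d} \<subseteq> S then ?w f else 0)
      = real ((n - d) choose (s - d)) * ?w f" .
  qed
  also have "\<dots> = real ((n - d) choose (s - d)) * det (cross_gram d X Y {..<n})"
    by (simp only: det_cross_gram[OF finite_lessThan] sum_distrib_left)
  finally show ?thesis .
qed

section \<open>The determinants of Cramer's rule for the masked matrix\<close>

lemma index_diag_indicator_mult:
  fixes X :: "real mat"
  assumes "X \<in> carrier_mat n d" "a < n" "k < d"
  shows "(diag_indicator n S * X) $$ (a, k) = (if a \<in> S then X $$ (a, k) else 0)"
proof -
  have "(diag_indicator n S * X) $$ (a, k)
      = (\<Sum>b\<in>{0..<n}. (if a = b \<and> a \<in> S then 1 else 0) * X $$ (b, k))"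
    using assms by (simp add: diag_indicator_def scalar_prod_def)
  also have "\<dots> = (\<Sum>b\<in>{0..<n}. if b = a then (if a \<in> S then X $$ (a, k) else 0) else 0)"
    by (intro sum.cong) auto
  finally show ?thesis using assms by simp
qed

lemma diag_indicator_mult_carrier [simp]:
  "X \<in> carrier_mat n d \<Longrightarrow> diag_indicator n S * X \<in> carrier_mat n d"
  by (auto simp: diag_indicator_def)

lemma diag_indicator_full_mult:
  fixes X :: "real mat"
  assumes "X \<in> carrier_mat n d"
  shows "diag_indicator n {..<n} * X = X"
proof (rule eq_matI)
  fix i j assume "i < dim_row X" "j < dim_col X"
  then show "(diag_indicator n {..<n} * X) $$ (i, j) = X $$ (i, j)"
    using index_diag_indicator_mult[OF assms, of i j] assms by simp
qed (use assms in \<open>auto simp: diag_indicator_def\<close>)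

text \<open>The zeroed rows contribute nothing, so the masked matrix has the same Gram determinant
  as the row submatrix in the sampling weights.\<close>

lemma gram_diag_indicator_mult:
  assumes X: "X \<in> carrier_mat n d" and S: "S \<subseteq> {..<n}"
  shows "transpose_mat (diag_indicator n S * X) * (diag_indicator n S * X) = gram_sum d X S"
proof (rule eq_matI)
  let ?A = "diag_indicator n S * X"
  have A: "?A \<in> carrier_mat n d" using X by simp
  then have dims: "dim_row ?A = n" "dim_col ?A = d" by auto
  fix i j assume "i < dim_row (gram_sum d X S)" "j < dim_col (gram_sum d X S)"
  then have ij: "i < d" "j < d" by (auto simp: gram_sum_def)
  have "(transpose_mat ?A * ?A) $$ (i, j) = (\<Sum>a\<in>{0..<n}. ?A $$ (a, i) * ?A $$ (a, j))"
    using ij dims by (simp add: index_mult_mat(1)[of i "transpose_mat ?A"] scalar_prod_def del: index_mult_mat(1))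
  also have "\<dots> = (\<Sum>a\<in>{0..<n}. if a \<in> S then X $$ (a, i) * X $$ (a, j) else 0)"
    using X ij by (intro sum.cong) (auto simp: index_diag_indicator_mult simp del: index_mult_mat(1))
  also have "\<dots> = (\<Sum>a\<in>S. X $$ (a, i) * X $$ (a, j))"
    using S by (simp add: sum.inter_restrict[symmetric] Int_absorb1 atLeast0LessThan)
  finally show "(transpose_mat ?A * ?A) $$ (i, j) = gram_sum d X S $$ (i, j)"
    using ij by (simp add: gram_sum_def)
qed (use X in \<open>auto simp: gram_sum_def\<close>)

text \<open>Pairing a column of X_S with the unit vector restricted to \<open>S\<close> picks out
  its entry in row \<open>j\<close> if \<open>j\<close> is in \<open>S\<close> and gives 0
  otherwise, which is what masking does to row \<open>j\<close>.\<close>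

lemma replace_col_gram_eq_cross_gram:
  assumes X: "X \<in> carrier_mat n d" and S: "S \<subseteq> {..<n}" and j: "j < n"
  shows "replace_col (gram_sum d X S) (row (diag_indicator n S * X) j) i
    = cross_gram d X (replace_col X (unit_vec n j) i) S"
proof (rule eq_matI)
  let ?A = "diag_indicator n S * X"
  let ?Y = "replace_col X (unit_vec n j) i"
  have A: "?A \<in> carrier_mat n d" using X by simp
  have fin: "finite S" using S finite_subset by blast
  fix k l assume "k < dim_row (cross_gram d X ?Y S)" "l < dim_col (cross_gram d X ?Y S)"
  then have kl: "k < d" "l < d" by (auto simp: cross_gram_def)
  show "replace_col (gram_sum d X S) (row ?A j) i $$ (k, l) = cross_gram d X ?Y S $$ (k, l)"
  proof (cases "l = i")
    case True
    have "(\<Sum>a\<in>S. X $$ (a, k) * ?Y $$ (a, l)) = (\<Sum>a\<in>S. if a = j then X $$ (j, k) else 0)"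
      using X S kl True j by (intro sum.cong) (auto simp: replace_col_def)
    also have "\<dots> = ?A $$ (j, k)"
      using fin j kl by (simp add: index_diag_indicator_mult[OF X])
    also have "\<dots> = row ?A j $ k"
      using A j kl by (intro index_row(1)[symmetric]) auto
    finally show ?thesis
      using kl True by (simp add: replace_col_def cross_gram_def gram_sum_def)
  next
    case False
    have "(\<Sum>a\<in>S. X $$ (a, k) * ?Y $$ (a, l)) = (\<Sum>a\<in>S. X $$ (a, k) * X $$ (a, l))"
      using X S kl False by (intro sum.cong) (auto simp: replace_col_def)
    then show ?thesis
      using kl False by (simp add: replace_col_def cross_gram_def gram_sum_def)
  qed
qed (auto simp: replace_col_def cross_gram_def gram_sum_def)

lemma det_gram_sum_mult_pseudoinverse:
  assumes X: "X \<in> carrier_mat n d" and S: "S \<subseteq> {..<n}" and i: "i < d" and j: "j < n"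
  shows "det (gram_sum d X S) * pseudoinverse (diag_indicator n S * X) $$ (i, j)
    = det (cross_gram d X (replace_col X (unit_vec n j) i) S)"
  using det_gram_mult_pseudoinverse[OF diag_indicator_mult_carrier[OF X] i j, of S]
  by (simp only: gram_diag_indicator_mult[OF X S] replace_col_gram_eq_cross_gram[OF X S j])

section \<open>Evaluation of the expectation\<close>

theorem theorem2p5:
  fixes X :: "real mat" and n d s :: nat
  assumes "X \<in> carrier_mat n d" and "n \<ge> d"
    and "vec_space.rank n X = d"
    and "s \<in> {d..n}"
  shows "expectation_mat d n (volume_sampling s X)
           (\<lambda>S. pseudoinverse (diag_indicator n S * X)) = pseudoinverse X"
proof (rule eq_matI)
  note X = assms(1)
  have s: "d \<le> s" "s \<le> n" using assms(4) by auto
  let ?g = "det (transpose_mat X * X)"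
  let ?c = "real ((n - d) choose (s - d))"
  let ?A = "{S. S \<subseteq> {..<n} \<and> card S = s}"
  let ?P = "\<lambda>S. pseudoinverse (diag_indicator n S * X)"
  have g: "?g > 0" by (rule det_gram_pos[OF X assms(3)])
  have c: "?c > 0" using s by simp
  \<comment> \<open>As \<open>pseudoinverse\<close> is a definite description, even its dimensions
    are known only through existence.\<close>
  have "is_pseudoinverse X (pseudoinverse X)"
    using is_pseudoinverse_pseudoinverse[OF X] g by simp
  then have P: "pseudoinverse X \<in> carrier_mat d n" using X by (simp add: is_pseudoinverse_def)
  note pmf = pmf_volume_sampling[OF X assms(3) s]
  show "dim_row (expectation_mat d n (volume_sampling s X) ?P) = dim_row (pseudoinverse X)"
    "dim_col (expectation_mat d n (volume_sampling s X) ?P) = dim_col (pseudoinverse X)"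
    using P by (auto simp: expectation_mat_def)
  fix i j assume "i < dim_row (pseudoinverse X)" "j < dim_col (pseudoinverse X)"
  then have i: "i < d" and j: "j < n" using P by auto
  let ?Y = "replace_col X (unit_vec n j) i"
  have "measure_pmf.expectation (volume_sampling s X) (\<lambda>S. ?P S $$ (i, j))
      = (\<Sum>S\<in>?A. ?P S $$ (i, j) * pmf (volume_sampling s X) S)"
  proof (rule integral_measure_pmf_real)
    fix S assume "S \<in> set_pmf (volume_sampling s X)"
    then show "S \<in> ?A" using pmf[of S] by (auto simp: set_pmf_iff split: if_splits)
  qed simp
  also have "\<dots> = (\<Sum>S\<in>?A. det (cross_gram d X ?Y S) / (?c * ?g))"
  proof (rule sum.cong[OF refl])
    fix S assume S: "S \<in> ?A"
    then have "pmf (volume_sampling s X) S = det (gram_sum d X S) / (?c * ?g)"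
      using pmf[of S] gram_rows_submatrix[OF X, of S] by simp
    \<comment> \<open>The Gram determinant in the weight of \<open>S\<close> is exactly the
      denominator of Cramer's rule.\<close>
    then show "?P S $$ (i, j) * pmf (volume_sampling s X) S
        = det (cross_gram d X ?Y S) / (?c * ?g)"
      using det_gram_sum_mult_pseudoinverse[OF X _ i j, of S] S by (simp add: mult.commute)
  qed
  also have "\<dots> = ?c * det (cross_gram d X ?Y {..<n}) / (?c * ?g)"
    using sum_det_cross_gram[OF s, of X ?Y] by (simp add: sum_divide_distrib[symmetric])
  \<comment> \<open>For the full index set the mask is the identity, so the same formula now gives
    an entry of the pseudoinverse of \<open>X\<close>.\<close>
  also have "det (cross_gram d X ?Y {..<n}) = ?g * pseudoinverse X $$ (i, j)"
    using det_gram_sum_mult_pseudoinverse[OF X order_refl i j]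
    by (simp only: diag_indicator_full_mult[OF X] gram_full[OF X])
  also have "?c * (?g * pseudoinverse X $$ (i, j)) / (?c * ?g) = pseudoinverse X $$ (i, j)"
    using g c by simp
  finally show "expectation_mat d n (volume_sampling s X) ?P $$ (i, j) = pseudoinverse X $$ (i, j)"
    using i j by (simp add: expectation_mat_def)
qed

end
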